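(* Let $F$ be a graph with chromatic number $\chi(F)>2$ and let $s$ be a positive integer. Let $\mathcal{F}$ be the family of graphs obtained from $F$ by deleting the vertices of one color class of a proper vertex coloring of $F$ (isolated vertices of the resulting graphs are kept). Then there is $n_0=n_0(F,s)$ such that for all $n\ge n_0$, $$\mathrm{ex}(n,\{F,M_{s+1}\})=\mathrm{ex}(s,\mathcal{F})+s(n-s).$$
   Context: For a family $\mathcal{G}$ of graphs, $\mathrm{ex}(n,\mathcal{G})$ denotes the maximum number of edges in an $n$-vertex graph containing no member of $\mathcal{G}$ as a (not necessarily induced) subgraph. $M_{s+1}$ denotes the matching consisting of $s+1$ pairwise disjoint edges, so $\{F,M_{s+1}\}$-free graphs are the $F$-free graphs with matching number at most $s$. *)

theory Defs
  imports Main
begin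

text \<open>An undirected simple graph is a vertex set together with a set of two-element vertex sets.\<close>

type_synonym 'a ugraph = "'a set \<times> 'a set set"

abbreviation verts :: "'a ugraph \<Rightarrow> 'a set" where
  "verts G \<equiv> fst G"

abbreviation edges :: "'a ugraph \<Rightarrow> 'a set set" where
  "edges G \<equiv> snd G"

definition fin_simple_graph :: "'a ugraph \<Rightarrow> bool" where
  "fin_simple_graph G \<longleftrightarrow> finite (verts G) \<and> (\<forall>e \<in> edges G. e \<subseteq> verts G \<and> card e = 2)"

text \<open>\<open>contains_copy H G\<close>: \<open>G\<close> has a (not necessarily induced) subgraph isomorphic to \<open>H\<close>.
  Isolated vertices of \<open>H\<close> need images of their own.\<close>

definition contains_copy :: "'b ugraph \<Rightarrow> 'a ugraph \<Rightarrow> bool" where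
  "contains_copy H G \<longleftrightarrow>
     (\<exists>f. inj_on f (verts H) \<and> f ` verts H \<subseteq> verts G \<and> (\<forall>e \<in> edges H. f ` e \<in> edges G))"

definition free_of :: "'b ugraph set \<Rightarrow> 'a ugraph \<Rightarrow> bool" where
  "free_of \<G> G \<longleftrightarrow> (\<forall>H \<in> \<G>. \<not> contains_copy H G)"

text \<open>Host graphs range over all graphs with \<open>n\<close> natural numbers as vertices, which covers every
  \<open>n\<close>-vertex graph up to isomorphism. The value is unspecified if no \<open>n\<close>-vertex graph is free
  of \<open>\<G>\<close>; this does not happen if every member of \<open>\<G>\<close> has an edge.\<close>

definition ex_number :: "nat \<Rightarrow> 'b ugraph set \<Rightarrow> nat" where
  "ex_number n \<G> =
     Max {card (edges G) |G :: nat ugraph. fin_simple_graph G \<and> card (verts G) = n \<and> free_of \<G> G}"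

definition matching_graph :: "nat \<Rightarrow> nat ugraph" where
  "matching_graph k = ({..<2 * k}, {{2 * i, 2 * i + 1} |i. i < k})"

definition proper_coloring :: "'a ugraph \<Rightarrow> ('a \<Rightarrow> nat) \<Rightarrow> bool" where
  "proper_coloring G c \<longleftrightarrow> (\<forall>u v. {u, v} \<in> edges G \<longrightarrow> c u \<noteq> c v)"

definition chromatic_number :: "'a ugraph \<Rightarrow> nat" where
  "chromatic_number G = (LEAST k. \<exists>c. proper_coloring G c \<and> c ` verts G \<subseteq> {..<k})"

definition delete_verts :: "'a ugraph \<Rightarrow> 'a set \<Rightarrow> 'a ugraph" where
  "delete_verts G S = (verts G - S, {e \<in> edges G. e \<inter> S = {}})"

text \<open>The coloring may use any number of colors, not only the chromatic number; color classes are
  the nonempty fibers of the coloring.\<close>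

definition color_class_deletions :: "'a ugraph \<Rightarrow> 'a ugraph set" where
  "color_class_deletions F =
     {delete_verts F {v \<in> verts F. c v = i} |c i. proper_coloring F c \<and> i \<in> c ` verts F}"

end

theory Submission
  imports Defs "HOL-Library.Disjoint_Sets"
begin

text \<open>
  For the lower bound, join an extremal graph on \<open>s\<close> vertices with an independent set of \<open>n - s\<close>
  vertices: the part of a copy of \<open>F\<close> lying in the independent set extends to a color class, and
  every edge uses one of the \<open>s\<close> original vertices.
  For the upper bound, let \<open>A\<close> be the set of vertices of degree at least \<open>2 * s + 2\<close>. Choosing
  neighbors greedily, \<open>card A > s\<close> would give a matching of size \<open>s + 1\<close>, and so would \<open>card A = s\<close>
  together with an edge avoiding \<open>A\<close>. If \<open>card A < s\<close>, then there are at most \<open>(s - 1) * n + O(1)\<close>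
  edges, because the ends of a maximum matching cover all edges. If \<open>card A = s\<close>, then either \<open>A\<close>
  induces a graph free of the family, or there are fewer than \<open>card (verts F)\<close> common neighbors
  of \<open>A\<close>, which costs about \<open>n\<close> edges.
\<close>

section \<open>Finite simple graphs\<close>

definition neighbors :: "'a ugraph \<Rightarrow> 'a \<Rightarrow> 'a set" where
  "neighbors G v = {w. {v, w} \<in> edges G}"

lemma edge_cases:
  assumes "fin_simple_graph G" "e \<in> edges G"
  obtains u v where "e = {u, v}" "u \<noteq> v" "u \<in> verts G" "v \<in> verts G"
  using assms unfolding fin_simple_graph_def by (metis card_2_iff insert_subset)

lemma finite_verts: "fin_simple_graph G \<Longrightarrow> finite (verts G)"
  by (simp add: fin_simple_graph_def)

lemma edges_subset_Pow: "fin_simple_graph G \<Longrightarrow> edges G \<subseteq> Pow (verts G)"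
  by (auto simp: fin_simple_graph_def)

lemma finite_edges: "fin_simple_graph G \<Longrightarrow> finite (edges G)"
  using edges_subset_Pow finite_verts by (metis finite_Pow_iff finite_subset)

lemma neighbors_subset: "fin_simple_graph G \<Longrightarrow> neighbors G v \<subseteq> verts G"
  by (auto simp: fin_simple_graph_def neighbors_def)

lemma finite_neighbors: "fin_simple_graph G \<Longrightarrow> finite (neighbors G v)"
  using neighbors_subset finite_verts finite_subset by metis

lemma card_edges_le_square:
  assumes "finite A" "\<And>e. e \<in> E \<Longrightarrow> e \<subseteq> A \<and> card e = 2"
  shows "card E \<le> card A * card A"
proof -
  have "E \<subseteq> (\<lambda>(u, v). {u, v}) ` (A \<times> A)"
  proof
    fix e assume "e \<in> E"
    then obtain u v where "e = {u, v}" "u \<in> A" "v \<in> A"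
      using assms(2) by (metis card_2_iff insert_subset)
    then show "e \<in> (\<lambda>(u, v). {u, v}) ` (A \<times> A)" by auto
  qed
  then have "card E \<le> card (A \<times> A)"
    by (rule surj_card_le[rotated]) (simp add: assms(1))
  then show ?thesis by (simp add: card_cartesian_product)
qed

text \<open>Charge each edge to an end in \<open>U\<close>. An edge with both ends in
  \<open>U\<close> appears in two neighborhoods, which is why only an inequality holds.\<close>

lemma card_edges_le_sum_degrees:
  assumes "fin_simple_graph G" "finite U" "\<And>e. e \<in> edges G \<Longrightarrow> e \<inter> U \<noteq> {}"
  shows "card (edges G) \<le> (\<Sum>v\<in>U. card (neighbors G v))"
proof -
  have "edges G \<subseteq> (\<Union>v\<in>U. (\<lambda>w. {v, w}) ` neighbors G v)"
  proof
    fix e assume e: "e \<in> edges G"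
    then obtain u v where uv: "e = {u, v}" using assms(1) edge_cases by metis
    then have "u \<in> U \<or> v \<in> U" using assms(3)[OF e] by auto
    then show "e \<in> (\<Union>v\<in>U. (\<lambda>w. {v, w}) ` neighbors G v)"
    proof
      assume "u \<in> U"
      then show ?thesis using e uv by (auto simp: neighbors_def)
    next
      assume "v \<in> U"
      moreover have "e = {v, u}" using uv by blast
      ultimately show ?thesis using e unfolding neighbors_def by blast
    qed
  qed
  then have "card (edges G) \<le> card (\<Union>v\<in>U. (\<lambda>w. {v, w}) ` neighbors G v)"
    by (intro card_mono) (auto simp: assms finite_neighbors)
  also have "\<dots> \<le> (\<Sum>v\<in>U. card ((\<lambda>w. {v, w}) ` neighbors G v))"
    by (rule card_UN_le[OF assms(2)])
  also have "\<dots> \<le> (\<Sum>v\<in>U. card (neighbors G v))"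
    by (intro sum_mono card_image_le finite_neighbors assms)
  finally show ?thesis .
qed

section \<open>Extremal numbers\<close>

text \<open>Infinitely many host graphs compete, since any \<open>n\<close> natural numbers may
  serve as vertices, but their edge counts stay below \<open>n * n\<close>. This makes the
  \<open>Max\<close> in \<open>ex_number\<close> meaningful.\<close>

lemma finite_edge_counts:
  "finite {card (edges G) |G :: nat ugraph.
     fin_simple_graph G \<and> card (verts G) = n \<and> free_of \<G> G}"
proof (rule finite_subset)
  show "{card (edges G) |G :: nat ugraph.
     fin_simple_graph G \<and> card (verts G) = n \<and> free_of \<G> G} \<subseteq> {..n * n}"
    using card_edges_le_square by (fastforce simp: fin_simple_graph_def)
qed simp

lemma card_edges_le_ex_number:
  fixes G :: "nat ugraph"
  assumes "fin_simple_graph G" "card (verts G) = n" "free_of \<G> G"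
  shows "card (edges G) \<le> ex_number n \<G>"
  unfolding ex_number_def using assms by (intro Max_ge finite_edge_counts) blast

text \<open>The given graph \<open>G\<close> only certifies that the set of edge counts is nonempty,
  so that its maximum is one of its members.\<close>

lemma ex_number_attained:
  fixes G :: "nat ugraph"
  assumes "fin_simple_graph G" "card (verts G) = n" "free_of \<G> G"
  obtains H :: "nat ugraph" where "fin_simple_graph H" "card (verts H) = n" "free_of \<G> H"
    "card (edges H) = ex_number n \<G>"
proof -
  have "ex_number n \<G> \<in> {card (edges G) |G :: nat ugraph.
     fin_simple_graph G \<and> card (verts G) = n \<and> free_of \<G> G}"
    unfolding ex_number_def by (rule Max_in[OF finite_edge_counts]) (use assms in blast)
  then show thesis using that by auto
qed

section \<open>Matchings\<close>

lemma contains_matching_graphI: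
  assumes G: "fin_simple_graph G" and M: "M \<subseteq> edges G" "disjoint M" "card M = k"
  shows "contains_copy (matching_graph k) G"
proof -
  have "finite M" using M(1) finite_edges[OF G] finite_subset by blast
  then obtain h where h: "bij_betw h {..<k} M"
    using ex_bij_betw_nat_finite[of M] M(3) by (auto simp: atLeast0LessThan)
  have hM: "h i \<in> M" if "i < k" for i
    using h that by (auto simp: bij_betw_def)
  have "\<forall>i. \<exists>a b. i < k \<longrightarrow> h i = {a, b} \<and> a \<noteq> b \<and> a \<in> verts G \<and> b \<in> verts G"
    using hM M(1) edge_cases[OF G] by (metis subsetD)
  then obtain a b where ab: "\<And>i. i < k \<Longrightarrow>
      h i = {a i, b i} \<and> a i \<noteq> b i \<and> a i \<in> verts G \<and> b i \<in> verts G"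
    by metis
  have dis: "h i \<inter> h j = {}" if "i < k" "j < k" "i \<noteq> j" for i j
    using that h hM disjointD[OF M(2)] by (metis bij_betw_imp_inj_on inj_onD lessThan_iff)
  \<comment> \<open>The vertices \<open>2 * i\<close> and \<open>2 * i + 1\<close> go to the two
    ends of the matching edge \<open>h i\<close>. Injectivity then splits in two: disjointness of
    the edges recovers \<open>m div 2\<close>, and \<open>a i \<noteq> b i\<close> recovers the
    parity of \<open>m\<close>.\<close>
  define f where "f m = (if even m then a (m div 2) else b (m div 2))" for m
  have fh: "f m \<in> h (m div 2)" if "m < 2 * k" for m
    using ab[of "m div 2"] that by (auto simp: f_def)
  have "inj_on f {..<2 * k}"
  proof (rule inj_onI)
    fix m m' assume m: "m \<in> {..<2 * k}" "m' \<in> {..<2 * k}" "f m = f m'"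
    then have k: "m div 2 < k" "m' div 2 < k" by auto
    have eq: "m div 2 = m' div 2"
      using dis[OF k] fh[of m] fh[of m'] m by auto
    have "even m = even m'"
      using m(3) ab[OF k(1)] eq by (auto simp: f_def split: if_splits)
    then show "m = m'" using eq by (metis div_mult_mod_eq even_iff_mod_2_eq_zero odd_iff_mod_2_eq_one)
  qed
  moreover have "f ` {..<2 * k} \<subseteq> verts G"
    using ab by (auto simp: f_def)
  moreover have "f ` {2 * i, 2 * i + 1} \<in> edges G" if "i < k" for i
    using ab[OF that] hM[OF that] M(1) by (auto simp: f_def insert_commute)
  ultimately show ?thesis
    unfolding contains_copy_def matching_graph_def by (intro exI[of _ f]) auto
qed

text \<open>The \<open>k\<close> disjoint image edges meet \<open>U\<close> in \<open>k\<close>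
  different vertices. This bounds the matching number of the lower-bound construction.\<close>

lemma matching_graph_le_cover:
  assumes "contains_copy (matching_graph k) G" "finite U" "\<And>e. e \<in> edges G \<Longrightarrow> e \<inter> U \<noteq> {}"
  shows "k \<le> card U"
proof -
  obtain f where inj: "inj_on f {..<2 * k}"
    and f: "\<forall>e\<in>{{2 * i, 2 * i + 1} |i. i < k}. f ` e \<in> edges G"
    using assms(1) unfolding contains_copy_def matching_graph_def fst_conv snd_conv by blast
  have e: "f ` {2 * i, 2 * i + 1} \<in> edges G" if "i < k" for i
    by (rule bspec[OF f]) (use that in blast)
  have "\<forall>i. \<exists>j. i < k \<longrightarrow> j \<in> {2 * i, 2 * i + 1} \<and> f j \<in> U"
    using assms(3)[OF e] by blast
  then obtain g where g: "\<And>i. i < k \<Longrightarrow> g i \<in> {2 * i, 2 * i + 1} \<and> f (g i) \<in> U"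
    by metis
  have "inj_on (\<lambda>i. f (g i)) {..<k}"
  proof (rule inj_onI)
    fix i j assume ij: "i \<in> {..<k}" "j \<in> {..<k}" "f (g i) = f (g j)"
    have lt: "g m < 2 * k" and half: "g m div 2 = m" if "m < k" for m
      using g[OF that] that by auto
    have "g i = g j"
      using inj_onD[OF inj ij(3)] lt ij(1,2) by simp
    then show "i = j" using half ij(1,2) by (metis lessThan_iff)
  qed
  then have "card {..<k} \<le> card U"
    by (rule card_inj_on_le) (use g assms(2) in auto)
  then show ?thesis by simp
qed

text \<open>The ends of a matching of maximum size form such a \<open>U\<close>: an edge missing all
  of them could be added to the matching.\<close>

lemma edge_cover_of_matching_free:
  assumes G: "fin_simple_graph G" and free: "\<not> contains_copy (matching_graph (s + 1)) G"
  obtains U where "U \<subseteq> verts G" "card U \<le> 2 * s" "\<And>e. e \<in> edges G \<Longrightarrow> e \<inter> U \<noteq> {}"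
proof -
  let ?P = "\<lambda>M. M \<subseteq> edges G \<and> disjoint M"
  have bound: "card M \<le> s" if M: "?P M" for M
  proof (rule ccontr)
    assume "\<not> card M \<le> s"
    then obtain M' where "M' \<subseteq> M" "card M' = s + 1"
      by (metis Suc_eq_plus1 not_less_eq_eq obtain_subset_with_card_n)
    then show False
      using contains_matching_graphI[OF G, of M' "s + 1"] M free
      by (meson disjoint_def subset_eq)
  qed
  have "\<exists>M. ?P M \<and> (\<forall>M'. ?P M' \<longrightarrow> card M' \<le> card M)"
    by (rule ex_has_greatest_nat[of ?P "{}" card "s + 1"]) (use bound in \<open>auto simp: less_Suc_eq_le\<close>)
  then obtain M where M: "?P M" and max: "\<And>M'. ?P M' \<Longrightarrow> card M' \<le> card M" by blast
  have finM: "finite M" using M finite_edges[OF G] finite_subset by blast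
  show thesis
  proof (rule that[of "\<Union>M"])
    show "\<Union>M \<subseteq> verts G" using M edges_subset_Pow[OF G] by blast
    have "card (\<Union>M) \<le> (\<Sum>e\<in>M. card e)" by (rule card_Union_le_sum_card)
    also have "\<dots> = (\<Sum>e\<in>M. 2)"
      using M G by (intro sum.cong) (auto simp: fin_simple_graph_def)
    also have "\<dots> \<le> 2 * s" using bound[OF M] by simp
    finally show "card (\<Union>M) \<le> 2 * s" .
    show "e \<inter> \<Union>M \<noteq> {}" if e: "e \<in> edges G" for e
    proof
      assume d: "e \<inter> \<Union>M = {}"
      have "e \<noteq> {}" using e edge_cases[OF G] by blast
      then have "e \<notin> M" using d by blast
      moreover have "?P (insert e M)"
        using M e d by (auto simp: disjoint_def)
      ultimately show False using max[of "insert e M"] finM by simp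
    qed
  qed
qed

text \<open>Greedy choice suffices, without Hall's condition: when \<open>x\<close> gets its turn,
  fewer than \<open>card (N x)\<close> elements are already taken.\<close>

lemma distinct_representatives_greedy:
  assumes "finite B" "\<And>v. v \<in> B \<Longrightarrow> finite (N v) \<and> card B \<le> card (N v)"
  shows "\<exists>w. inj_on w B \<and> (\<forall>v\<in>B. w v \<in> N v)"
  using assms
proof (induction B rule: finite_induct)
  case (insert x B)
  then obtain w where w: "inj_on w B" "\<forall>v\<in>B. w v \<in> N v" by fastforce
  have "card (w ` B) < card (N x)"
    using insert.prems[of x] insert.hyps card_image_le[of B w] by simp
  then obtain y where y: "y \<in> N x" "y \<notin> w ` B"
    using insert.hyps by (metis card_mono finite_imageI linorder_not_less subsetI)
  have "inj_on (w(x := y)) (insert x B)"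
    using w(1) y insert.hyps by (auto simp: inj_on_def)
  moreover have "\<forall>v\<in>insert x B. (w(x := y)) v \<in> N v"
    using w(2) y insert.hyps by auto
  ultimately show ?case by blast
qed auto

text \<open>Each vertex of \<open>B\<close> is matched to a private neighbor outside
  \<open>B\<close> and \<open>X\<close>. Removing \<open>B\<close> and \<open>X\<close> from a
  neighborhood costs at most \<open>card B + card X\<close> vertices, so \<open>card B\<close>
  candidates remain and the greedy choice applies. The set \<open>X\<close> reserves room for a
  further edge.\<close>

lemma matching_from_degrees:
  assumes G: "fin_simple_graph G" and fin: "finite B" "finite X" and BX: "B \<inter> X = {}"
    and deg: "\<And>v. v \<in> B \<Longrightarrow> 2 * card B + card X \<le> card (neighbors G v)"
  obtains M where "M \<subseteq> edges G" "disjoint M" "card M = card B" "\<Union>M \<inter> X = {}"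
proof -
  let ?N = "\<lambda>v. neighbors G v - (B \<union> X)"
  have "card B \<le> card (?N v)" if "v \<in> B" for v
  proof -
    have "card (neighbors G v) - card (B \<union> X) \<le> card (?N v)"
      by (rule diff_card_le_card_Diff) (use fin in auto)
    then show ?thesis using deg[OF that] card_Un_le[of B X] by linarith
  qed
  then obtain w where w: "inj_on w B" "\<forall>v\<in>B. w v \<in> ?N v"
    using distinct_representatives_greedy[OF fin(1), of ?N] finite_neighbors[OF G] by auto
  let ?e = "\<lambda>v. {v, w v}"
  have dis: "?e u \<inter> ?e v = {}" if "u \<in> B" "v \<in> B" "u \<noteq> v" for u v
    using that w by (auto dest: inj_onD)
  show thesis
  proof (rule that[of "?e ` B"])
    show "?e ` B \<subseteq> edges G" using w(2) by (auto simp: neighbors_def)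
    show "disjoint (?e ` B)"
    proof (rule disjointI)
      fix x y assume "x \<in> ?e ` B" "y \<in> ?e ` B" "x \<noteq> y"
      then obtain u v where "x = ?e u" "y = ?e v" "u \<in> B" "v \<in> B" "u \<noteq> v" by auto
      then show "x \<inter> y = {}" using dis[of u v] by simp
    qed
    have "inj_on ?e B"
    proof (rule inj_onI, rule ccontr)
      fix u v assume "u \<in> B" "v \<in> B" "?e u = ?e v" "u \<noteq> v"
      then show False using dis[of u v] by simp
    qed
    then show "card (?e ` B) = card B" by (rule card_image)
    show "\<Union>(?e ` B) \<inter> X = {}" using w(2) BX by auto
  qed
qed

section \<open>Colorings\<close>

lemma not_two_colorable:
  assumes "chromatic_number F > 2" "proper_coloring F c"
  shows "\<not> c ` verts F \<subseteq> {..<2}"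
proof
  assume "c ` verts F \<subseteq> {..<2}"
  then have "chromatic_number F \<le> 2"
    unfolding chromatic_number_def using assms(2) by (intro Least_le) auto
  then show False using assms(1) by simp
qed

lemma verts_nonempty_of_chromatic_number:
  assumes "fin_simple_graph F" "chromatic_number F > 2"
  shows "verts F \<noteq> {}"
proof
  assume "verts F = {}"
  then have "proper_coloring F (\<lambda>_. 0)"
    using assms(1) by (auto simp: fin_simple_graph_def proper_coloring_def)
  then show False using not_two_colorable[OF assms(2)] \<open>verts F = {}\<close> by blast
qed

text \<open>If the deleted class met every edge, merging all other classes into one would give a
  proper 2-coloring of \<open>F\<close>. Consequently edgeless graphs are free of the family, and
  its extremal numbers are attained.\<close>

lemma color_class_deletion_has_edge:
  assumes F: "fin_simple_graph F" "chromatic_number F > 2"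
    and H: "H \<in> color_class_deletions F"
  shows "edges H \<noteq> {}"
proof
  assume "edges H = {}"
  obtain c i where c: "proper_coloring F c" and H: "H = delete_verts F {v \<in> verts F. c v = i}"
    using H unfolding color_class_deletions_def by auto
  have hit: "e \<inter> {v \<in> verts F. c v = i} \<noteq> {}" if "e \<in> edges F" for e
    using \<open>edges H = {}\<close> that unfolding H delete_verts_def by auto
  have "proper_coloring F (\<lambda>v. if c v = i then 0 else 1)"
    unfolding proper_coloring_def
  proof (intro allI impI)
    fix u v assume e: "{u, v} \<in> edges F"
    then have "c u \<noteq> c v" using c by (auto simp: proper_coloring_def)
    then show "(if c u = i then 0 else 1) \<noteq> (if c v = i then 0 else (1::nat))"
      using hit[OF e] by auto
  qed
  then show False by (rule notE[OF not_two_colorable[OF F(2)]]) auto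
qed

text \<open>Give \<open>S\<close> the color 0 and all other vertices pairwise different positive
  colors. Here it matters that colorings may use arbitrarily many colors; \<open>S\<close> is
  nonempty so that color 0 occurs.\<close>

lemma independent_deletion_in_color_class_deletions:
  assumes F: "fin_simple_graph F" and S: "S \<subseteq> verts F" "S \<noteq> {}"
    and indep: "\<And>e. e \<in> edges F \<Longrightarrow> \<not> e \<subseteq> S"
  shows "delete_verts F S \<in> color_class_deletions F"
proof -
  obtain h :: "_ \<Rightarrow> nat" where h: "inj_on h (verts F)"
    using finite_verts[OF F] finite_imp_inj_to_nat_seg by blast
  define c where "c v = (if v \<in> S then 0 else Suc (h v))" for v
  have "proper_coloring F c"
    unfolding proper_coloring_def
  proof (intro allI impI)
    fix u v assume e: "{u, v} \<in> edges F"
    then have "u \<in> verts F" "v \<in> verts F" "u \<noteq> v"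
      using F by (auto simp: fin_simple_graph_def)
    then show "c u \<noteq> c v"
      using indep[OF e] h by (auto simp: c_def dest: inj_onD)
  qed
  moreover have "0 \<in> c ` verts F" using S by (force simp: c_def)
  moreover have "S = {v \<in> verts F. c v = 0}" using S by (auto simp: c_def)
  ultimately show ?thesis unfolding color_class_deletions_def by blast
qed

section \<open>The lower bound\<close>

definition join_independent :: "'a ugraph \<Rightarrow> 'a set \<Rightarrow> 'a ugraph" where
  "join_independent G W = (verts G \<union> W, edges G \<union> {{a, w} |a w. a \<in> verts G \<and> w \<in> W})"

lemma join_independent_simple:
  assumes "fin_simple_graph G" "finite W" "verts G \<inter> W = {}"
  shows "fin_simple_graph (join_independent G W)"
  using assms by (auto simp: fin_simple_graph_def join_independent_def card_insert_if)

lemma card_join_edges: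
  assumes "A \<inter> W = {}"
  shows "card {{a, w} |a w. a \<in> A \<and> w \<in> W} = card A * card W"
proof -
  have "inj_on (\<lambda>(a, w). {a, w}) (A \<times> W)"
    using assms by (auto simp: inj_on_def doubleton_eq_iff)
  moreover have "{{a, w} |a w. a \<in> A \<and> w \<in> W} = (\<lambda>(a, w). {a, w}) ` (A \<times> W)" by auto
  ultimately show ?thesis by (metis card_image card_cartesian_product)
qed

lemma card_edges_join_independent:
  assumes "fin_simple_graph G" "finite W" "verts G \<inter> W = {}"
  shows "card (edges (join_independent G W)) = card (edges G) + card (verts G) * card W"
proof -
  let ?C = "{{a, w} |a w. a \<in> verts G \<and> w \<in> W}"
  have "?C = (\<lambda>(a, w). {a, w}) ` (verts G \<times> W)" by auto
  then have "finite ?C" using assms finite_verts[OF assms(1)] by simp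
  moreover have "edges G \<inter> ?C = {}"
    using edges_subset_Pow[OF assms(1)] assms(3) by auto
  ultimately show ?thesis
    using finite_edges[OF assms(1)] card_join_edges[OF assms(3)]
    by (simp add: join_independent_def card_Un_disjoint)
qed

text \<open>Every edge of the join meets \<open>verts G\<close>, so the vertices of \<open>F\<close>
  sent into \<open>W\<close> form an independent set \<open>S\<close>. What remains of the copy
  shows \<open>delete_verts F S\<close>, a member of the family, inside \<open>G\<close>.\<close>

lemma join_independent_F_free:
  assumes F: "fin_simple_graph F" "verts F \<noteq> {}"
    and G: "fin_simple_graph G" "verts G \<inter> W = {}"
    and free: "free_of (color_class_deletions F) G"
  shows "\<not> contains_copy F (join_independent G W)"
proof
  assume "contains_copy F (join_independent G W)"
  then obtain f where f: "inj_on f (verts F)" "f ` verts F \<subseteq> verts G \<union> W"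
    "\<And>e. e \<in> edges F \<Longrightarrow> f ` e \<in> edges (join_independent G W)"
    unfolding contains_copy_def join_independent_def by auto
  have hit: "e \<inter> verts G \<noteq> {}" if "e \<in> edges (join_independent G W)" for e
    using that G(1) by (auto simp: join_independent_def elim: edge_cases)
  have inside: "e \<in> edges G" if "e \<in> edges (join_independent G W)" "e \<subseteq> verts G" for e
    using that G(2) by (auto simp: join_independent_def)
  obtain S where S: "S \<subseteq> verts F" "S \<noteq> {}" "\<And>e. e \<in> edges F \<Longrightarrow> \<not> e \<subseteq> S"
    "f ` (verts F - S) \<subseteq> verts G"
  proof (cases "f ` verts F \<subseteq> verts G")
    \<comment> \<open>No vertex is sent into \<open>W\<close>, and the empty set is not a color
      class; any single vertex serves as \<open>S\<close> instead.\<close>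
    case True
    obtain v where "v \<in> verts F" using F(2) by blast
    moreover have "\<not> e \<subseteq> {v}" if "e \<in> edges F" for e
      using that by (rule edge_cases[OF F(1)]) auto
    ultimately show thesis using True by (intro that[of "{v}"]) auto
  next
    case False
    have "\<not> e \<subseteq> {v \<in> verts F. f v \<notin> verts G}" if "e \<in> edges F" for e
      using hit[OF f(3)[OF that]] by auto
    then show thesis using False by (intro that[of "{v \<in> verts F. f v \<notin> verts G}"]) auto
  qed
  have "contains_copy (delete_verts F S) G"
    unfolding contains_copy_def
  proof (intro exI conjI ballI)
    show "inj_on f (verts (delete_verts F S))"
      using f(1) by (auto simp: delete_verts_def inj_on_def)
    show "f ` verts (delete_verts F S) \<subseteq> verts G"
      using S(4) by (simp add: delete_verts_def)
    fix e assume "e \<in> edges (delete_verts F S)"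
    then have e: "e \<in> edges F" "e \<inter> S = {}" by (auto simp: delete_verts_def)
    then have "e \<subseteq> verts F - S" using edges_subset_Pow[OF F(1)] by blast
    then show "f ` e \<in> edges G" using inside[OF f(3)[OF e(1)]] S(4) by blast
  qed
  moreover have "delete_verts F S \<in> color_class_deletions F"
    using independent_deletion_in_color_class_deletions[OF F(1) S(1-3)] .
  ultimately show False using free by (auto simp: free_of_def)
qed

lemma extremal_construction:
  fixes F :: "'b ugraph"
  assumes F: "fin_simple_graph F" "chromatic_number F > 2" and "s \<le> n"
  obtains G :: "nat ugraph" where "fin_simple_graph G" "card (verts G) = n"
    "\<not> contains_copy F G" "\<not> contains_copy (matching_graph (s + 1)) G"
    "card (edges G) = ex_number s (color_class_deletions F) + s * (n - s)"
proof -
  \<comment> \<open>The edgeless graph on \<open>s\<close> vertices witnesses that an extremal graph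
    \<open>H\<close> for the family exists.\<close>
  have "free_of (color_class_deletions F) ({..<s}, {})"
    using color_class_deletion_has_edge[OF F] by (fastforce simp: free_of_def contains_copy_def)
  then obtain H :: "nat ugraph" where H: "fin_simple_graph H" "card (verts H) = s"
    "free_of (color_class_deletions F) H"
    "card (edges H) = ex_number s (color_class_deletions F)"
    by (rule ex_number_attained[rotated 2]) (auto simp: fin_simple_graph_def)
  have "infinite (- verts H)" using finite_verts[OF H(1)] by simp
  then obtain W where W: "finite W" "card W = n - s" "W \<subseteq> - verts H"
    by (meson infinite_arbitrarily_large)
  then have dis: "verts H \<inter> W = {}" by blast
  let ?G = "join_independent H W"
  show thesis
  proof (rule that[of ?G])
    show "fin_simple_graph ?G" by (rule join_independent_simple[OF H(1) W(1) dis])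
    show "card (verts ?G) = n"
      using dis W H(2) finite_verts[OF H(1)] \<open>s \<le> n\<close>
      by (simp add: join_independent_def card_Un_disjoint)
    show "\<not> contains_copy F ?G"
      by (rule join_independent_F_free[OF F(1) verts_nonempty_of_chromatic_number[OF F] H(1) dis H(3)])
    \<comment> \<open>The \<open>s\<close> vertices of \<open>H\<close> cover all edges of the join,
      which rules out \<open>s + 1\<close> disjoint edges.\<close>
    have hit: "e \<inter> verts H \<noteq> {}" if "e \<in> edges ?G" for e
      using that H(1) by (auto simp: join_independent_def elim: edge_cases)
    show "\<not> contains_copy (matching_graph (s + 1)) ?G"
      using matching_graph_le_cover[of "s + 1" ?G "verts H"] hit finite_verts[OF H(1)] H(2) by auto
    show "card (edges ?G) = ex_number s (color_class_deletions F) + s * (n - s)"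
      using card_edges_join_independent[OF H(1) W(1) dis] H W by simp
  qed
qed

section \<open>The upper bound\<close>

text \<open>Keep the copy of \<open>H\<close> in \<open>A\<close> and place the deleted color class
  injectively into \<open>C\<close>, which is large enough. No edge of \<open>F\<close> lies within
  that class, and an edge leaving it lands on a pair between \<open>A\<close> and \<open>C\<close>,
  all of which are edges of \<open>G\<close>.\<close>

lemma contains_copy_of_common_neighbors:
  assumes F: "fin_simple_graph F" and H: "H \<in> color_class_deletions F"
    and copy: "contains_copy H (A, E)" and E: "E \<subseteq> edges G" and A: "A \<subseteq> verts G"
    and C: "C \<subseteq> verts G - A" "finite C" "\<And>a w. a \<in> A \<Longrightarrow> w \<in> C \<Longrightarrow> {a, w} \<in> edges G"
    and card: "card (verts F) \<le> card C"
  shows "contains_copy F G"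
proof -
  obtain c i where c: "proper_coloring F c" and Hc: "H = delete_verts F {v \<in> verts F. c v = i}"
    using H unfolding color_class_deletions_def by auto
  define S where "S = {v \<in> verts F. c v = i}"
  have Hv: "verts H = verts F - S" and He: "edges H = {e \<in> edges F. e \<inter> S = {}}"
    by (simp_all add: Hc S_def delete_verts_def)
  obtain f where f: "inj_on f (verts F - S)" "f ` (verts F - S) \<subseteq> A"
    "\<And>e. e \<in> edges F \<Longrightarrow> e \<inter> S = {} \<Longrightarrow> f ` e \<in> E"
    using copy unfolding contains_copy_def Hv He by auto
  have "S \<subseteq> verts F" by (auto simp: S_def)
  then have "finite S" "card S \<le> card C"
    using card card_mono[OF finite_verts[OF F]] finite_subset[OF _ finite_verts[OF F]]
    by (auto intro: order_trans)
  then obtain g where g: "inj_on g S" "g ` S \<subseteq> C"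
    using C(2) card_le_inj by metis
  define h where "h v = (if v \<in> S then g v else f v)" for v
  have mixed: "{h u, h v} \<in> edges G" if "{u, v} \<in> edges F" "u \<in> S" for u v
  proof -
    have "v \<in> verts F" using that edges_subset_Pow[OF F] by blast
    moreover have "c u \<noteq> c v" using that c by (auto simp: proper_coloring_def)
    ultimately have "v \<in> verts F - S" using that by (auto simp: S_def)
    then have "h v \<in> A" "h u \<in> C" using f(2) g(2) that by (auto simp: h_def)
    then show ?thesis using C(3) by (metis insert_commute)
  qed
  show ?thesis
    unfolding contains_copy_def
  proof (intro exI conjI ballI)
    show "inj_on h (verts F)"
    proof (rule inj_onI)
      fix u v assume uv: "u \<in> verts F" "v \<in> verts F" "h u = h v"
      have "f x \<noteq> g y" if "x \<in> verts F - S" "y \<in> S" for x y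
        using that f(2) g(2) C(1) by blast
      then show "u = v" using uv f(1) g(1)
        by (cases "u \<in> S"; cases "v \<in> S"; simp add: h_def inj_on_def) metis+
    qed
    show "h ` verts F \<subseteq> verts G"
      using f(2) g(2) C(1) A unfolding h_def by auto
    fix e assume e: "e \<in> edges F"
    show "h ` e \<in> edges G"
    proof (cases "e \<inter> S = {}")
      case True
      then have "h ` e = f ` e" by (intro image_cong) (auto simp: h_def)
      then show ?thesis using f(3)[OF e True] E by auto
    next
      case False
      obtain u v where uv: "e = {u, v}" using e edge_cases[OF F] by metis
      then consider "u \<in> S" | "v \<in> S" using False by blast
      then show ?thesis
        using mixed[of u v] mixed[of v u] e uv by cases (auto simp: insert_commute)
    qed
  qed
qed

text \<open>The threshold \<open>2 * s + 2\<close> is exactly what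
  \<open>matching_from_degrees\<close> asks of \<open>s + 1\<close> vertices when \<open>X\<close>
  is empty.\<close>

lemma few_large_degrees:
  assumes G: "fin_simple_graph G" and free: "\<not> contains_copy (matching_graph (s + 1)) G"
    and A: "A \<subseteq> verts G" "\<And>v. v \<in> A \<Longrightarrow> 2 * s + 2 \<le> card (neighbors G v)"
  shows "card A \<le> s"
proof (rule ccontr)
  assume "\<not> card A \<le> s"
  then obtain B where B: "B \<subseteq> A" "card B = s + 1" "finite B"
    by (metis Suc_eq_plus1 not_less_eq_eq obtain_subset_with_card_n)
  have "2 * card B + card {} \<le> card (neighbors G v)" if "v \<in> B" for v
    using A(2)[of v] B that by auto
  then obtain M where "M \<subseteq> edges G" "disjoint M" "card M = card B"
    by (rule matching_from_degrees[OF G B(3), of "{}", rotated 2]) auto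
  then show False using contains_matching_graphI[OF G] B(2) free by metis
qed

text \<open>The same threshold now reads \<open>2 * card A + card e\<close>: the vertices of
  \<open>A\<close> carry a matching of size \<open>s\<close> that avoids \<open>e\<close>, and
  adding \<open>e\<close> would give \<open>s + 1\<close> disjoint edges.\<close>

lemma large_degrees_cover:
  assumes G: "fin_simple_graph G" and free: "\<not> contains_copy (matching_graph (s + 1)) G"
    and A: "A \<subseteq> verts G" "card A = s" "\<And>v. v \<in> A \<Longrightarrow> 2 * s + 2 \<le> card (neighbors G v)"
    and e: "e \<in> edges G"
  shows "e \<inter> A \<noteq> {}"
proof
  assume eA: "e \<inter> A = {}"
  have ce: "card e = 2" "finite e" using e G card_ge_0_finite[of e]
    by (auto simp: fin_simple_graph_def)
  have finA: "finite A" using A(1) finite_verts[OF G] finite_subset by blast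
  obtain M where M: "M \<subseteq> edges G" "disjoint M" "card M = s" "\<Union>M \<inter> e = {}"
    using matching_from_degrees[OF G finA ce(2)] A eA ce(1) by (auto simp: Int_commute)
  have "e \<noteq> {}" using ce by auto
  then have "e \<notin> M" using M(4) by blast
  moreover have "finite M" using M(1) finite_edges[OF G] finite_subset by blast
  ultimately have "card (insert e M) = s + 1" using M(3) by simp
  moreover have "disjoint (insert e M)" using M(2,4) by (auto simp: disjoint_def)
  ultimately show False
    using contains_matching_graphI[OF G, of "insert e M" "s + 1"] M(1) e free by auto
qed

text \<open>Take the cover \<open>U\<close> of at most \<open>2 * s\<close> vertices and enlarge it
  by \<open>A\<close>. Vertices of \<open>A\<close> contribute at most \<open>n\<close> each, and
  those of \<open>U - A\<close> have degree below \<open>d\<close>, leaving an error term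
  independent of \<open>n\<close>.\<close>

lemma card_edges_few_large_degrees:
  assumes G: "fin_simple_graph G" "card (verts G) = n"
    and free: "\<not> contains_copy (matching_graph (s + 1)) G"
    and A: "A = {v \<in> verts G. d \<le> card (neighbors G v)}"
  shows "card (edges G) \<le> card A * n + 2 * s * d"
proof -
  obtain U where U: "U \<subseteq> verts G" "card U \<le> 2 * s" "\<And>e. e \<in> edges G \<Longrightarrow> e \<inter> U \<noteq> {}"
    by (rule edge_cover_of_matching_free[OF G(1) free]) blast
  have fin: "finite A" "finite U"
    using A U(1) finite_subset[OF _ finite_verts[OF G(1)]] by auto
  have "e \<inter> (A \<union> (U - A)) \<noteq> {}" if "e \<in> edges G" for e
    using U(3)[OF that] by blast
  then have "card (edges G) \<le> (\<Sum>v\<in>A \<union> (U - A). card (neighbors G v))"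
    by (intro card_edges_le_sum_degrees G(1)) (use fin in auto)
  also have "\<dots> = (\<Sum>v\<in>A. card (neighbors G v)) + (\<Sum>v\<in>U - A. card (neighbors G v))"
    by (rule sum.union_disjoint) (use fin in auto)
  also have "\<dots> \<le> of_nat (card A) * n + of_nat (card (U - A)) * d"
  proof (intro add_mono sum_bounded_above)
    show "card (neighbors G v) \<le> n" for v
      using card_mono[OF finite_verts[OF G(1)] neighbors_subset[OF G(1)]] G(2) by simp
    show "card (neighbors G v) \<le> d" if "v \<in> U - A" for v
      using that U(1) A by auto
  qed
  also have "\<dots> \<le> card A * n + 2 * s * d"
    using U(2) card_mono[of U "U - A"] fin by (auto intro!: mult_right_mono)
  finally show ?thesis .
qed

text \<open>An edge meeting \<open>A\<close> either lies inside \<open>A\<close> or has exactly one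
  end \<open>w\<close> outside; edges of the second kind are counted by \<open>w\<close>.\<close>

lemma card_edges_covered:
  assumes G: "fin_simple_graph G" and A: "A \<subseteq> verts G"
    and cover: "\<And>e. e \<in> edges G \<Longrightarrow> e \<inter> A \<noteq> {}"
  shows "card (edges G) \<le> card {e \<in> edges G. e \<subseteq> A}
    + (\<Sum>w\<in>verts G - A. card {a \<in> A. {a, w} \<in> edges G})"
proof -
  let ?I = "{e \<in> edges G. e \<subseteq> A}"
  let ?N = "\<lambda>w. {a \<in> A. {a, w} \<in> edges G}"
  let ?X = "\<Union>w\<in>verts G - A. (\<lambda>a. {a, w}) ` ?N w"
  have finA: "finite A" using A finite_verts[OF G] finite_subset by blast
  have finN: "finite (?N w)" for w using finA by simp
  have "edges G \<subseteq> ?I \<union> ?X"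
  proof
    fix e assume e: "e \<in> edges G"
    obtain u v where uv: "e = {u, v}" "u \<in> verts G" "v \<in> verts G"
      using e edge_cases[OF G] by metis
    have "u \<in> A \<or> v \<in> A" using cover[OF e] uv by auto
    then consider "u \<in> A" "v \<in> A" | "u \<in> A" "v \<in> verts G - A" | "v \<in> A" "u \<in> verts G - A"
      using uv by blast
    then show "e \<in> ?I \<union> ?X"
    proof cases
      case 1 then show ?thesis using e uv by auto
    next
      case 2 then show ?thesis using e uv by blast
    next
      case 3
      have "e = {v, u}" using uv by (simp add: insert_commute)
      then show ?thesis using 3 e by blast
    qed
  qed
  then have "card (edges G) \<le> card (?I \<union> ?X)"
    by (intro card_mono) (auto simp: finite_edges[OF G] finite_verts[OF G] finA)
  also have "\<dots> \<le> card ?I + card ?X" by (rule card_Un_le)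
  also have "card ?X \<le> (\<Sum>w\<in>verts G - A. card ((\<lambda>a. {a, w}) ` ?N w))"
    by (rule card_UN_le) (simp add: finite_verts[OF G])
  also have "\<dots> \<le> (\<Sum>w\<in>verts G - A. card (?N w))"
    by (intro sum_mono card_image_le finN)
  finally show ?thesis by simp
qed

text \<open>The bound on \<open>n\<close> serves two cases. If \<open>card A < s\<close>, it needs
  \<open>s * s + 2 * s * (2 * s + 2)\<close>, since one summand \<open>n\<close> must absorb the
  error term. If \<open>A\<close> induces a member of the family, it needs
  \<open>s * s + s + card (verts F)\<close>, to absorb the edges inside \<open>A\<close> and the few
  common neighbors. In both cases even \<open>s * (n - s)\<close> bounds the number of
  edges.\<close>

lemma card_edges_upper_bound:
  fixes F :: "'b ugraph" and G :: "nat ugraph"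
  assumes F: "fin_simple_graph F" and s: "s > 0"
    and G: "fin_simple_graph G" "card (verts G) = n"
    and Ffree: "\<not> contains_copy F G"
    and Mfree: "\<not> contains_copy (matching_graph (s + 1)) G"
    and n: "n \<ge> s * s + s + card (verts F) + 2 * s * (2 * s + 2)"
  shows "card (edges G) \<le> ex_number s (color_class_deletions F) + s * (n - s)"
proof -
  define A where "A = {v \<in> verts G. 2 * s + 2 \<le> card (neighbors G v)}"
  have AV: "A \<subseteq> verts G" and deg: "\<And>v. v \<in> A \<Longrightarrow> 2 * s + 2 \<le> card (neighbors G v)"
    by (auto simp: A_def)
  have finA: "finite A" using AV finite_verts[OF G(1)] finite_subset by blast
  have cA: "card A \<le> s" by (rule few_large_degrees[OF G(1) Mfree AV deg])
  show ?thesis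
  proof (cases "card A < s")
    case True
    \<comment> \<open>Writing \<open>s - 1\<close> as \<open>t\<close> avoids truncated
      subtraction.\<close>
    obtain t where t: "s = Suc t" using s gr0_implies_Suc by blast
    have "card (edges G) \<le> card A * n + 2 * s * (2 * s + 2)"
      by (rule card_edges_few_large_degrees[OF G Mfree A_def])
    also have "card A * n \<le> t * n" using True t by simp
    also have "t * n + 2 * s * (2 * s + 2) \<le> s * n - s * s"
      using n t by simp
    also have "\<dots> = s * (n - s)" by (simp add: diff_mult_distrib2)
    finally show ?thesis by simp
  next
    case False
    then have As: "card A = s" using cA by simp
    have cover: "e \<inter> A \<noteq> {}" if "e \<in> edges G" for e
      by (rule large_degrees_cover[OF G(1) Mfree AV As deg that])
    let ?I = "{e \<in> edges G. e \<subseteq> A}"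
    let ?W = "verts G - A"
    let ?N = "\<lambda>w. {a \<in> A. {a, w} \<in> edges G}"
    have W: "finite ?W" "card ?W = n - s"
      using G As AV finA by (auto simp: finite_verts card_Diff_subset)
    have le: "card (edges G) \<le> card ?I + (\<Sum>w\<in>?W. card (?N w))"
      by (rule card_edges_covered[OF G(1) AV cover])
    have Ns: "card (?N w) \<le> s" for w
      using card_mono[of A "?N w"] finA As by auto
    show ?thesis
    proof (cases "free_of (color_class_deletions F) (A, ?I)")
      case True
      have "fin_simple_graph (A, ?I)"
        using G(1) finA by (auto simp: fin_simple_graph_def)
      then have "card ?I \<le> ex_number s (color_class_deletions F)"
        using card_edges_le_ex_number[OF _ _ True] As by simp
      moreover have "(\<Sum>w\<in>?W. card (?N w)) \<le> of_nat (card ?W) * s"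
        by (intro sum_bounded_above Ns)
      ultimately show ?thesis using le W by (simp add: mult.commute)
    next
      case False
      then obtain H where H: "H \<in> color_class_deletions F" "contains_copy H (A, ?I)"
        by (auto simp: free_of_def)
      define C where "C = {w \<in> ?W. \<forall>a\<in>A. {a, w} \<in> edges G}"
      have C: "C \<subseteq> ?W" "finite C" using W finite_verts[OF G(1)] by (auto simp: C_def)
      have cC: "card C < card (verts F)"
      proof (rule ccontr)
        assume "\<not> card C < card (verts F)"
        then have "contains_copy F G"
          by (intro contains_copy_of_common_neighbors[OF F H _ AV C]) (auto simp: C_def)
        then show False using Ffree by blast
      qed
      have "card ?I \<le> s * s"
        using card_edges_le_square[OF finA, of ?I] G(1) As by (auto simp: fin_simple_graph_def)
      \<comment> \<open>Each vertex outside \<open>A\<close> and \<open>C\<close> misses some vertex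
        of \<open>A\<close>, so the count falls short of \<open>s * (n - s)\<close> by at least
        \<open>n - s - card C\<close>. The inequality is stated additively because subtraction
        truncates.\<close>
      moreover have "(\<Sum>w\<in>?W. card (?N w)) + (n - s) \<le> s * (n - s) + card C"
      proof -
        have N1: "card (?N w) + 1 \<le> s + (if w \<in> C then 1 else 0)" if "w \<in> ?W" for w
        proof (cases "w \<in> C")
          case False
          then have "?N w \<subset> A" using that by (auto simp: C_def)
          then have "card (?N w) < s" using psubset_card_mono[OF finA] As by metis
          then show ?thesis using False by simp
        qed (use Ns in simp)
        have "(\<Sum>w\<in>?W. card (?N w)) + (n - s) = (\<Sum>w\<in>?W. card (?N w) + 1)"
          using W by (simp add: sum_Suc)
        also have "\<dots> \<le> (\<Sum>w\<in>?W. s + (if w \<in> C then 1 else 0))"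
          by (rule sum_mono[OF N1])
        also have "\<dots> = s * (n - s) + card (?W \<inter> C)"
          using W by (simp add: sum.distrib sum.If_cases mult.commute)
        also have "?W \<inter> C = C" using C by blast
        finally show ?thesis .
      qed
      \<comment> \<open>The loss \<open>n - s\<close> outweighs the gains \<open>s * s\<close> and
        \<open>card C\<close>.\<close>
      ultimately show ?thesis using le cC n by linarith
    qed
  qed
qed

theorem theorem1:
  fixes F :: "nat ugraph" and s :: nat
  assumes "fin_simple_graph F"
    and "chromatic_number F > 2"
    and "s > 0"
  shows "\<exists>n\<^sub>0. \<forall>n \<ge> n\<^sub>0.
    ex_number n {F, matching_graph (s + 1)}
      = ex_number s (color_class_deletions F) + s * (n - s)"
proof (intro exI allI impI antisym)
  \<comment> \<open>This fixes the \<open>n\<^sub>0\<close> left open by \<open>exI\<close> to the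
    threshold of \<open>card_edges_upper_bound\<close>, which also exceeds \<open>s\<close> enough
    for the construction.\<close>
  fix n assume n: "n \<ge> s * s + s + card (verts F) + 2 * s * (2 * s + 2)"
  then have "s \<le> n" by linarith
  then obtain G :: "nat ugraph" where G: "fin_simple_graph G" "card (verts G) = n"
    "free_of {F, matching_graph (s + 1)} G"
    "card (edges G) = ex_number s (color_class_deletions F) + s * (n - s)"
    by (rule extremal_construction[OF assms(1,2)]) (auto simp: free_of_def)
  show "ex_number s (color_class_deletions F) + s * (n - s)
      \<le> ex_number n {F, matching_graph (s + 1)}"
    using card_edges_le_ex_number[OF G(1-3)] G(4) by simp
  \<comment> \<open>The construction \<open>G\<close> also guarantees that a free graph on
    \<open>n\<close> vertices exists, so the extremal number is attained by some
    \<open>H\<close>.\<close>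
  obtain H :: "nat ugraph" where "fin_simple_graph H" "card (verts H) = n"
    "free_of {F, matching_graph (s + 1)} H"
    "card (edges H) = ex_number n {F, matching_graph (s + 1)}"
    by (rule ex_number_attained[OF G(1-3)])
  then show "ex_number n {F, matching_graph (s + 1)}
      \<le> ex_number s (color_class_deletions F) + s * (n - s)"
    using card_edges_upper_bound[OF assms(1,3) _ _ _ _ n, of H] by (simp add: free_of_def)
qed

end
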